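(* Let $d>0$. Let $\tau=\{t_n,\ n\in\mathbb{Z}\}$ be any sampling point process satisfying Assumptions A1, A2 and A4 (stated in the context, A4 with this $d$). Then $\tau$ is not alias-free, in the sense of Definition 1 (stated in the context), relative to the class $\mathbb{S}$ of all spectra. That is, there exist two processes with different spectral distributions that yield the same covariance sequence $R$ of the sampled process.
   Context: Processes: $X=\{X(t),\ -\infty<t<\infty\}$ denotes a real, mean square continuous, wide sense stationary stochastic process with mean zero, covariance function $C(t)=E[X(s+t)X(s)]$ and spectral distribution (spectrum) $\Phi$, i.e. the finite measure on $\mathbb{R}$ with $C(t)=\int_{-\infty}^{\infty}e^{i\lambda t}\,d\Phi(\lambda)$ (up to an immaterial normalizing constant). The class of all spectra is the class of spectral distributions of all such processes. Sampling process: $\tau=\{t_n,\ n=\ldots,-2,-1,0,1,2,\ldots\}$ is a sequence of real-valued, stochastic sampling times. Assumption A1: the process $\tau$ is independent of $X$ (for every process $X$ considered). Assumption A2: the sequence of sampling times $\tau$ constitutes a stationary point process, such that the probability distribution of $t_{m+n}-t_m$ does not depend on $m$. Assumption A4: the time separation between two successive sample points is at least $d$, i.e. $t_{n+1}-t_n\ge d$ for every index $n$, for the fixed $d>0$. Under A1 and A2 the covariance sequence of the sampled process is $R=\{r(n),\ n\in\mathbb{Z}\}$, where $r(n)=E[X(t_{m+n})X(t_m)]$ for integers $m,n$, and the expectation is taken without conditioning on the sampling times. Definition 1: a sampling process $\tau$ satisfying A1 and A2 is alias-free relative to a class of spectra $\mathbb{S}$ if no two random processes with different spectra belonging to $\mathbb{S}$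 yield the same covariance sequence $R$ of the sampled process. *)

theory Defs
  imports "HOL-Probability.Probability"
begin

(* Joint measurability in (t, omega) is what makes the sampled variables X(t_m) random variables. *)
definition wss_process :: "'w measure \<Rightarrow> (real \<Rightarrow> 'w \<Rightarrow> real) \<Rightarrow> bool" where
  "wss_process M X \<longleftrightarrow>
     prob_space M \<and>
     case_prod X \<in> borel_measurable (borel \<Otimes>\<^sub>M M) \<and>
     (\<forall>t. integrable M (\<lambda>\<omega>. (X t \<omega>)\<^sup>2)) \<and>
     (\<forall>t. (\<integral>\<omega>. X t \<omega> \<partial>M) = 0) \<and>
     (\<forall>s s' t. (\<integral>\<omega>. X (s + t) \<omega> * X s \<omega> \<partial>M) = (\<integral>\<omega>. X (s' + t) \<omega> * X s' \<omega> \<partial>M)) \<and>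
     (\<forall>t. ((\<lambda>s. \<integral>\<omega>. (X s \<omega> - X t \<omega>)\<^sup>2 \<partial>M) \<longlongrightarrow> 0) (at t))"

(* char \<Phi> t is the integral of exp (i t x) against \<Phi>, here for a finite measure \<Phi>
   of arbitrary total mass C(0). *)
definition has_spectrum :: "'w measure \<Rightarrow> (real \<Rightarrow> 'w \<Rightarrow> real) \<Rightarrow> real measure \<Rightarrow> bool" where
  "has_spectrum M X \<Phi> \<longleftrightarrow>
     finite_measure \<Phi> \<and> sets \<Phi> = sets borel \<and>
     (\<forall>s t. complex_of_real (\<integral>\<omega>. X (s + t) \<omega> * X s \<omega> \<partial>M) = char \<Phi> t)"

(* The sample space type nat => real, with an arbitrary sigma-algebra and measure, is no
   restriction: a jointly measurable process is measurable with respect to borel and a countably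
   generated sigma-algebra on its sample space, hence factors through a sequence of random
   variables. *)
definition all_spectra :: "real measure set" where
  "all_spectra = {\<Phi>. \<exists>(M :: (nat \<Rightarrow> real) measure) X. wss_process M X \<and> has_spectrum M X \<Phi>}"

definition sampling_process :: "'b measure \<Rightarrow> (int \<Rightarrow> 'b \<Rightarrow> real) \<Rightarrow> bool" where
  "sampling_process N \<tau> \<longleftrightarrow> prob_space N \<and> (\<forall>n. \<tau> n \<in> borel_measurable N)"

definition stationary_sampling :: "'b measure \<Rightarrow> (int \<Rightarrow> 'b \<Rightarrow> real) \<Rightarrow> bool" where
  "stationary_sampling N \<tau> \<longleftrightarrow>
     (\<forall>m m' n. distr N borel (\<lambda>\<eta>. \<tau> (m + n) \<eta> - \<tau> m \<eta>) =
                distr N borel (\<lambda>\<eta>. \<tau> (m' + n) \<eta> - \<tau> m' \<eta>))"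

definition separated_sampling :: "'b measure \<Rightarrow> (int \<Rightarrow> 'b \<Rightarrow> real) \<Rightarrow> real \<Rightarrow> bool" where
  "separated_sampling N \<tau> d \<longleftrightarrow> (AE \<eta> in N. \<forall>n. \<tau> (n + 1) \<eta> - \<tau> n \<eta> \<ge> d)"

(* Independence of X and \<tau> is realized by letting X depend on the first and \<tau> on the second
   coordinate of the product probability space; see the next lemma. *)
definition has_sampled_covariance ::
  "'w measure \<Rightarrow> (real \<Rightarrow> 'w \<Rightarrow> real) \<Rightarrow> 'b measure \<Rightarrow> (int \<Rightarrow> 'b \<Rightarrow> real) \<Rightarrow> (int \<Rightarrow> real) \<Rightarrow> bool" where
  "has_sampled_covariance M X N \<tau> r \<longleftrightarrow>
     (\<forall>m n. r n = (\<integral>(\<omega>, \<eta>). X (\<tau> (m + n) \<eta>) \<omega> * X (\<tau> m \<eta>) \<omega> \<partial>(M \<Otimes>\<^sub>M N)))"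

lemma process_indep_sampling:
  fixes X :: "real \<Rightarrow> 'w \<Rightarrow> real" and \<tau> :: "int \<Rightarrow> 'b \<Rightarrow> real"
  assumes "wss_process M X" "sampling_process N \<tau>"
  defines "P \<equiv> M \<Otimes>\<^sub>M N"
  shows "prob_space.indep_set P
           {(\<lambda>p s. X s (fst p)) -` A \<inter> space P | A. A \<in> sets (\<Pi>\<^sub>M s\<in>UNIV. borel)}
           {(\<lambda>p n. \<tau> n (snd p)) -` B \<inter> space P | B. B \<in> sets (\<Pi>\<^sub>M n\<in>UNIV. borel)}"
proof -
  interpret M: prob_space M using assms(1) by (simp add: wss_process_def)
  interpret N: prob_space N using assms(2) by (simp add: sampling_process_def)
  interpret PP: pair_prob_space M N ..
  interpret P: prob_space P unfolding P_def by (rule PP.prob_space_axioms)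
  let ?S = "\<Pi>\<^sub>M s\<in>(UNIV :: real set). (borel :: real measure)"
  let ?T = "\<Pi>\<^sub>M n\<in>(UNIV :: int set). (borel :: real measure)"
  have XJ: "case_prod X \<in> borel_measurable (borel \<Otimes>\<^sub>M M)"
    using assms(1) by (simp add: wss_process_def)
  have "X s \<in> borel_measurable M" for s
    using measurable_Pair2[OF XJ, of s] by simp
  then have f: "(\<lambda>\<omega> s. X s \<omega>) \<in> measurable M ?S"
    by (intro measurable_PiM_single') auto
  have g: "(\<lambda>\<eta> n. \<tau> n \<eta>) \<in> measurable N ?T"
    using assms(2) by (intro measurable_PiM_single') (auto simp: sampling_process_def)
  define U where "U A = (\<lambda>\<omega> s. X s \<omega>) -` A \<inter> space M" for A
  define V where "V B = (\<lambda>\<eta> n. \<tau> n \<eta>) -` B \<inter> space N" for B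
  have U: "(\<lambda>p s. X s (fst p)) -` A \<inter> space P = U A \<times> space N" for A
    by (auto simp: U_def P_def space_pair_measure)
  have V: "(\<lambda>p n. \<tau> n (snd p)) -` B \<inter> space P = space M \<times> V B" for B
    by (auto simp: V_def P_def space_pair_measure)
  have Um: "U A \<in> sets M" if "A \<in> sets ?S" for A
    unfolding U_def using measurable_sets[OF f that] .
  have Vm: "V B \<in> sets N" if "B \<in> sets ?T" for B
    unfolding V_def using measurable_sets[OF g that] .
  have m: "P.prob (C \<times> D) = M.prob C * N.prob D" if "C \<in> sets M" "D \<in> sets N" for C D
    unfolding P_def using that by (simp add: measure_def N.emeasure_pair_measure_Times enn2real_mult)
  have eq: "P.prob (U A \<times> space N \<inter> space M \<times> V B) = P.prob (U A \<times> space N) * P.prob (space M \<times> V B)"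
    if "A \<in> sets ?S" "B \<in> sets ?T" for A B
  proof -
    have "U A \<times> space N \<inter> space M \<times> V B = U A \<times> V B"
      by (auto simp: U_def V_def)
    then show ?thesis
      using m[OF Um[OF that(1)] Vm[OF that(2)]] m[OF Um[OF that(1)] sets.top]
        m[OF sets.top Vm[OF that(2)]] by (simp add: M.prob_space N.prob_space)
  qed
  show ?thesis
    unfolding U V
    by (rule P.indep_setI) (auto simp: eq[unfolded P_def] P_def intro!: Um Vm pair_measureI)
qed

definition alias_free :: "'b measure \<Rightarrow> (int \<Rightarrow> 'b \<Rightarrow> real) \<Rightarrow> real measure set \<Rightarrow> bool" where
  "alias_free N \<tau> S \<longleftrightarrow>
     \<not> (\<exists>(M\<^sub>1 :: (nat \<Rightarrow> real) measure) X\<^sub>1 \<Phi>\<^sub>1 (M\<^sub>2 :: (nat \<Rightarrow> real) measure) X\<^sub>2 \<Phi>\<^sub>2 r.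
          wss_process M\<^sub>1 X\<^sub>1 \<and> has_spectrum M\<^sub>1 X\<^sub>1 \<Phi>\<^sub>1 \<and> \<Phi>\<^sub>1 \<in> S \<and>
          wss_process M\<^sub>2 X\<^sub>2 \<and> has_spectrum M\<^sub>2 X\<^sub>2 \<Phi>\<^sub>2 \<and> \<Phi>\<^sub>2 \<in> S \<and>
          \<Phi>\<^sub>1 \<noteq> \<Phi>\<^sub>2 \<and>
          has_sampled_covariance M\<^sub>1 X\<^sub>1 N \<tau> r \<and> has_sampled_covariance M\<^sub>2 X\<^sub>2 N \<tau> r)"

end

theory Submission
  imports Defs
begin

text \<open>
  The covariance \<open>r n\<close> of the samples is the average of the covariance function \<open>C\<close> over the
  law of \<open>\<tau> (m + n) - \<tau> m\<close>. Because successive samples are at least \<open>d\<close> apart, for \<open>n \<noteq> 0\<close> this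
  law does not charge the interval \<open>(-d, d)\<close>: apart from the variance \<open>C 0\<close>, the samples say nothing
  about \<open>C\<close> inside that interval. Two covariance functions with the same value at \<open>0\<close> that differ
  only inside \<open>(-d, d)\<close> therefore cannot be told apart. The triangles
  \<open>C t = max 0 (1 - \<bar>t\<bar> / a)\<close> with \<open>a = d\<close> and \<open>a = d / 2\<close> are such a pair, and both turn the samples
  into an uncorrelated sequence of variance \<open>1\<close> (\<open>exists_uncorrelated_sampled_process\<close>).

  Two things have to be supplied. The triangle must be the characteristic function of a measure;
  this measure has the Fejer density, proportional to \<open>(1 - cos (a * x)) / x\<^sup>2\<close>
  (\<open>char_fejer_spectrum\<close>). And a process with this spectrum must exist; a randomly signed wave whose
  frequency is drawn from the spectrum has this property (\<open>exists_process_with_spectrum\<close>).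
\<close>

section \<open>A spectrum whose covariance function is a triangle\<close>

text \<open>
  Integrability at infinity comes from \<open>1 - cos x \<le> 2\<close>, at the origin from \<open>1 - cos x \<le> x\<^sup>2 / 2\<close>; the
  multiple \<open>4 / (1 + x\<^sup>2)\<close> of the Cauchy density dominates both regimes at once.
\<close>
lemma integrable_one_minus_cos_over_square:
  "integrable lborel (\<lambda>x::real. (1 - cos (c * x)) / x\<^sup>2)"
proof -
  have base: "integrable lborel (\<lambda>x::real. (1 - cos x) / x\<^sup>2)"
  proof (rule Bochner_Integration.integrable_bound)
    show "integrable lborel (\<lambda>x::real. 4 * inverse (1 + x\<^sup>2))"
      using integrable_inverse_1_plus_square by (simp add: set_integrable_def)
    show "AE x::real in lborel. norm ((1 - cos x) / x\<^sup>2) \<le> norm (4 * inverse (1 + x\<^sup>2))"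
    proof (rule AE_I2)
      fix x :: real
      have half: "1 - cos x = 2 * (sin (x / 2))\<^sup>2"
        using cos_double_sin[of "x / 2"] by simp
      have "(sin (x / 2))\<^sup>2 \<le> (x / 2)\<^sup>2"
        using abs_sin_x_le_abs_x[of "x / 2"] unfolding abs_le_square_iff .
      then have quarter: "(sin (x / 2))\<^sup>2 \<le> x\<^sup>2 / 4"
        by (simp add: power_divide)
      have "(sin (x / 2))\<^sup>2 * x\<^sup>2 \<le> 1 * x\<^sup>2"
        by (rule mult_right_mono) (simp_all add: abs_square_le_1)
      moreover have "(1 - cos x) * (1 + x\<^sup>2) = 2 * (sin (x / 2))\<^sup>2 + 2 * ((sin (x / 2))\<^sup>2 * x\<^sup>2)"
        unfolding half by (simp add: algebra_simps)
      ultimately have "(1 - cos x) * (1 + x\<^sup>2) \<le> 4 * x\<^sup>2"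
        using quarter zero_le_power2[of x] by linarith
      then have "(1 - cos x) / x\<^sup>2 \<le> 4 * inverse (1 + x\<^sup>2)"
        by (cases "x = 0") (simp_all add: field_simps add_pos_nonneg)
      then show "norm ((1 - cos x) / x\<^sup>2) \<le> norm (4 * inverse (1 + x\<^sup>2))"
        by simp
    qed
  qed simp
  show ?thesis
  proof (cases "c = 0")
    case False
    then show ?thesis
      using integrable_mult_right[OF lborel_integrable_real_affine[OF base False, of 0], of "c\<^sup>2"]
      by (simp add: power_mult_distrib)
  qed simp
qed

text \<open>The value is \<open>\<pi>\<close>; as a normalizing constant it enters only through its positivity.\<close>
definition fejer_mass :: real where
  "fejer_mass = (\<integral>x. (1 - cos x) / x\<^sup>2 \<partial>lborel)"

text \<open>
  Substituting \<open>c * x\<close> for \<open>x\<close> shows how the integral scales. This is where the absolute value in the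
  triangle comes from.
\<close>
lemma integral_one_minus_cos_over_square:
  "(\<integral>x. (1 - cos (c * x)) / x\<^sup>2 \<partial>lborel) = fejer_mass * \<bar>c\<bar>"
proof (cases "c = 0")
  case False
  have "fejer_mass = \<bar>c\<bar> * (\<integral>x. (1 - cos (c * x)) / (c * x)\<^sup>2 \<partial>lborel)"
    using lborel_integral_real_affine[OF False, of "\<lambda>x. (1 - cos x) / x\<^sup>2" 0]
    by (simp add: fejer_mass_def)
  also have "(\<lambda>x. (1 - cos (c * x)) / (c * x)\<^sup>2) = (\<lambda>x. (1 - cos (c * x)) / x\<^sup>2 / c\<^sup>2)"
    by (simp add: power_mult_distrib mult.commute)
  also have "\<bar>c\<bar> * (\<integral>x. (1 - cos (c * x)) / x\<^sup>2 / c\<^sup>2 \<partial>lborel) =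
      \<bar>c\<bar> * ((\<integral>x. (1 - cos (c * x)) / x\<^sup>2 \<partial>lborel) / \<bar>c\<bar>\<^sup>2)"
    by (simp del: divide_divide_eq_left)
  finally show ?thesis
    using False by (simp add: field_simps power2_eq_square del: abs_mult_self_eq)
qed simp

lemma fejer_mass_pos: "fejer_mass > 0"
proof -
  let ?f = "\<lambda>x::real. (1 - cos x) / x\<^sup>2"
  have "fejer_mass \<ge> 0"
    unfolding fejer_mass_def by (intro integral_nonneg_AE) simp
  moreover have "fejer_mass \<noteq> 0"
  proof
    assume "fejer_mass = 0"
    then have "AE x in lborel. ?f x = 0"
      using integral_nonneg_eq_0_iff_AE[of lborel ?f] integrable_one_minus_cos_over_square[of 1]
      by (simp add: fejer_mass_def)
    moreover have "?f x \<noteq> 0" if "x \<in> {0<..<1}" for x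
      using that cos_monotone_0_pi[of 0 x] pi_gt3 by simp
    ultimately have "AE x in lborel. x \<notin> {0<..<1::real}"
      by (elim eventually_mono) blast
    then have "emeasure lborel {0<..<1::real} = 0"
      by (subst (asm) AE_iff_measurable[where N = "{0<..<1}"]) auto
    then show False by simp
  qed
  ultimately show ?thesis by simp
qed

definition fejer_density :: "real \<Rightarrow> real \<Rightarrow> real" where
  "fejer_density a x = (1 - cos (a * x)) / x\<^sup>2 / (fejer_mass * a)"

definition fejer_spectrum :: "real \<Rightarrow> real measure" where
  "fejer_spectrum a = density lborel (fejer_density a)"

lemma fejer_density_nonneg: "a > 0 \<Longrightarrow> fejer_density a x \<ge> 0"
  using fejer_mass_pos by (simp add: fejer_density_def)

lemma fejer_density_measurable [measurable]: "fejer_density a \<in> borel_measurable borel"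
  unfolding fejer_density_def by measurable

lemma integrable_fejer_density: "integrable lborel (fejer_density a)"
  unfolding fejer_density_def
  by (rule integrable_divide_zero) (rule integrable_one_minus_cos_over_square)

text \<open>
  The product-to-sum formula writes \<open>(1 - cos (a * x)) * cos (t * x)\<close> as a combination of the terms
  \<open>1 - cos (c * x)\<close> with \<open>c\<close> one of \<open>a + t\<close>, \<open>a - t\<close> and \<open>t\<close>. Each of them, divided by \<open>x\<^sup>2\<close>,
  integrates to a multiple of \<open>\<bar>c\<bar>\<close>, and \<open>\<bar>a + t\<bar> / 2 + \<bar>a - t\<bar> / 2 - \<bar>t\<bar>\<close> is the triangle of
  height \<open>a\<close> on \<open>[-a, a]\<close>.
\<close>
lemma fejer_cosine_transform:
  assumes "a > 0"
  shows "(\<integral>x. fejer_density a x * cos (t * x) \<partial>lborel) = max 0 (1 - \<bar>t\<bar> / a)"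
proof -
  define g :: "real \<Rightarrow> real \<Rightarrow> real" where "g c x = (1 - cos (c * x)) / x\<^sup>2" for c x
  have int: "integrable lborel (g c)" and val: "(\<integral>x. g c x \<partial>lborel) = fejer_mass * \<bar>c\<bar>" for c
    unfolding g_def
    by (rule integrable_one_minus_cos_over_square, rule integral_one_minus_cos_over_square)
  have split: "fejer_density a x * cos (t * x) =
      (g (a + t) x / 2 + g (a - t) x / 2 - g t x) / (fejer_mass * a)" for x
  proof -
    have "cos ((a + t) * x) + cos ((a - t) * x) = 2 * cos (a * x) * cos (t * x)"
      by (simp add: algebra_simps cos_add cos_diff)
    then have "(1 - cos (a * x)) * cos (t * x) =
        (1 - cos ((a + t) * x)) / 2 + (1 - cos ((a - t) * x)) / 2 - (1 - cos (t * x))"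
      by (simp add: left_diff_distrib field_split_simps)
    then have "(1 - cos (a * x)) * cos (t * x) / x\<^sup>2 =
        ((1 - cos ((a + t) * x)) / 2 + (1 - cos ((a - t) * x)) / 2 - (1 - cos (t * x))) / x\<^sup>2"
      by simp
    then have num: "(1 - cos (a * x)) / x\<^sup>2 * cos (t * x) = g (a + t) x / 2 + g (a - t) x / 2 - g t x"
      unfolding g_def times_divide_eq_left by (simp add: add_divide_distrib diff_divide_distrib)
    show ?thesis
      unfolding fejer_density_def num[symmetric] by simp
  qed
  have "(\<integral>x. fejer_density a x * cos (t * x) \<partial>lborel) =
      (fejer_mass * \<bar>a + t\<bar> / 2 + fejer_mass * \<bar>a - t\<bar> / 2 - fejer_mass * \<bar>t\<bar>) / (fejer_mass * a)"
    unfolding split using int by (simp add: val)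
  also have "\<dots> = (\<bar>a + t\<bar> / 2 + \<bar>a - t\<bar> / 2 - \<bar>t\<bar>) / a"
    using fejer_mass_pos assms by (simp add: field_simps)
  also have "\<dots> = max 0 (1 - \<bar>t\<bar> / a)"
  proof -
    have "\<bar>a + t\<bar> / 2 + \<bar>a - t\<bar> / 2 - \<bar>t\<bar> = max 0 (a - \<bar>t\<bar>)"
      using assms by (simp add: abs_if max_def) (simp add: field_simps)
    then show ?thesis
      using assms by (simp add: max_def field_simps)
  qed
  finally show ?thesis .
qed

lemma real_distribution_fejer_spectrum:
  assumes "a > 0"
  shows "real_distribution (fejer_spectrum a)"
proof -
  have "emeasure (fejer_spectrum a) UNIV = 1"
    using fejer_cosine_transform[OF assms, of 0] fejer_density_nonneg[OF assms]
      integrable_fejer_density[of a]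
    by (simp add: fejer_spectrum_def emeasure_density nn_integral_eq_integral)
  then have "prob_space (fejer_spectrum a)"
    by (intro prob_spaceI) (simp add: fejer_spectrum_def)
  then show ?thesis
    by (simp add: real_distribution_def real_distribution_axioms_def fejer_spectrum_def)
qed

lemma (in real_distribution) Re_char: "Re (char M t) = (\<integral>x. cos (t * x) \<partial>M)"
  and Im_char: "Im (char M t) = (\<integral>x. sin (t * x) \<partial>M)"
proof -
  have int: "integrable M (\<lambda>x. iexp (t * x))"
    by (rule integrable_iexp) auto
  show "Re (char M t) = (\<integral>x. cos (t * x) \<partial>M)"
    unfolding char_def integral_Re[OF int, symmetric] by (simp add: Re_exp)
  show "Im (char M t) = (\<integral>x. sin (t * x) \<partial>M)"
    unfolding char_def integral_Im[OF int, symmetric] by (simp add: Im_exp)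
qed

lemma char_fejer_spectrum:
  assumes "a > 0"
  shows "char (fejer_spectrum a) t = complex_of_real (max 0 (1 - \<bar>t\<bar> / a))"
proof (rule complex_eqI)
  interpret real_distribution "fejer_spectrum a"
    by (rule real_distribution_fejer_spectrum[OF assms])
  have dens: "(\<integral>x. f x \<partial>fejer_spectrum a) = (\<integral>x. fejer_density a x * f x \<partial>lborel)"
    if "f \<in> borel_measurable borel" for f :: "real \<Rightarrow> real"
    unfolding fejer_spectrum_def using that fejer_density_nonneg[OF assms]
    by (subst integral_density) auto
  show "Re (char (fejer_spectrum a) t) = Re (complex_of_real (max 0 (1 - \<bar>t\<bar> / a)))"
    by (simp add: Re_char dens fejer_cosine_transform[OF assms])
  let ?I = "\<integral>x. fejer_density a x * sin (t * x) \<partial>lborel"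
  have "?I = (\<integral>x. fejer_density a (- x) * sin (t * - x) \<partial>lborel)"
    using lborel_integral_real_affine[of "- 1" "\<lambda>x. fejer_density a x * sin (t * x)" 0] by simp
  also have "\<dots> = - ?I"
    by (simp add: fejer_density_def)
  finally show "Im (char (fejer_spectrum a) t) = Im (complex_of_real (max 0 (1 - \<bar>t\<bar> / a)))"
    by (simp add: Im_char dens)
qed

section \<open>Realizing a symmetric spectrum by a process\<close>

text \<open>
  Let \<open>\<Lambda>\<close> have law \<open>\<Phi>\<close>, let \<open>\<epsilon>\<close> be an independent fair sign, and put
  \<open>X t = \<epsilon> * (cos (t * \<Lambda>) + sin (t * \<Lambda>))\<close>. The sign makes the mean vanish and cancels in products,
  where \<open>X (s + t) * X s = cos (t * \<Lambda>) + sin ((2 * s + t) * \<Lambda>)\<close>. The sine has expectation zero since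
  the characteristic function of \<open>\<Phi>\<close> is real, which leaves a covariance that depends on \<open>t\<close> only.
  The pair of \<open>\<Lambda>\<close> and \<open>\<epsilon>\<close> is stored in the entries \<open>0\<close> and \<open>1\<close> of a sequence, so that the sample
  space has the type asked for by \<open>all_spectra\<close>.
\<close>
lemma exists_process_with_spectrum:
  assumes "real_distribution \<Phi>" and real: "\<And>t. Im (char \<Phi> t) = 0"
  shows "\<exists>(M :: (nat \<Rightarrow> real) measure) X. wss_process M X \<and> has_spectrum M X \<Phi>"
proof -
  interpret Phi: real_distribution \<Phi> by fact
  define B where "B = measure_pmf (bernoulli_pmf (1/2))"
  interpret B: prob_space B unfolding B_def by (rule measure_pmf.prob_space_axioms)
  interpret PB: pair_prob_space \<Phi> B ..
  define Pi where "Pi = (\<Pi>\<^sub>M i\<in>(UNIV :: nat set). (borel :: real measure))"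
  define emb :: "real \<times> bool \<Rightarrow> nat \<Rightarrow> real" where
    "emb = (\<lambda>p i. if i = 0 then fst p else if snd p then 1 else - 1)"
  define M where "M = distr (\<Phi> \<Otimes>\<^sub>M B) Pi emb"
  define X :: "real \<Rightarrow> (nat \<Rightarrow> real) \<Rightarrow> real" where
    "X = (\<lambda>t \<omega>. \<omega> 1 * (cos (t * \<omega> 0) + sin (t * \<omega> 0)))"
  have sgn_meas: "(\<lambda>b. if b then 1 else - 1 :: real) \<in> borel_measurable B"
    by (simp add: B_def)
  have emb [measurable]: "emb \<in> measurable (\<Phi> \<Otimes>\<^sub>M B) Pi"
    unfolding Pi_def emb_def
  proof (rule measurable_PiM_single')
    fix i :: nat
    show "(\<lambda>p. if i = 0 then fst p else if snd p then 1 else - 1) \<in> borel_measurable (\<Phi> \<Otimes>\<^sub>M B)"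
      using measurable_compose[OF measurable_snd sgn_meas, of \<Phi>]
      by (cases "i = 0") (simp_all add: measurable_fst')
  qed auto
  have comp [measurable]: "(\<lambda>\<omega>. \<omega> i) \<in> borel_measurable Pi" for i
    unfolding Pi_def by simp
  interpret M: prob_space M
    unfolding M_def by (rule PB.P.prob_space_distr) (rule emb)
  have X_meas [measurable]: "X t \<in> borel_measurable Pi" for t
    unfolding X_def by measurable
  have XM [measurable]: "X t \<in> borel_measurable M" for t
    unfolding M_def by simp
  have joint: "case_prod X \<in> borel_measurable (borel \<Otimes>\<^sub>M M)"
  proof -
    have "case_prod X \<in> borel_measurable (borel \<Otimes>\<^sub>M Pi)"
      unfolding X_def by measurable
    moreover have "sets (borel \<Otimes>\<^sub>M M) = sets (borel \<Otimes>\<^sub>M Pi :: (real \<times> (nat \<Rightarrow> real)) measure)"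
      by (rule sets_pair_measure_cong) (simp_all add: M_def)
    ultimately show ?thesis by (simp cong: measurable_cong_sets)
  qed
  have X_emb: "X t (emb (l, b)) = (if b then 1 else - 1) * (cos (t * l) + sin (t * l))" for t l b
    by (simp add: X_def emb_def)
  have bound: "\<bar>X t (emb p)\<bar> \<le> 2" for t p
  proof (cases p)
    case (Pair l b)
    show ?thesis
      unfolding Pair X_emb
      using order_trans[OF abs_triangle_ineq add_mono[OF abs_cos_le_one abs_sin_le_one],
          of "t * l" "t * l"]
      by (simp add: abs_mult)
  qed
  have AE_bound: "AE \<omega> in M. \<bar>X t \<omega>\<bar> \<le> 2" for t
    unfolding M_def by (subst AE_distr_iff) (auto simp: bound)
  have int_prod: "integrable M (\<lambda>\<omega>. X s \<omega> * X t \<omega>)" for s t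
  proof (rule M.integrable_const_bound[where B = 4])
    show "AE \<omega> in M. norm (X s \<omega> * X t \<omega>) \<le> 4"
      using AE_bound[of s] AE_bound[of t]
    proof eventually_elim
      case (elim \<omega>)
      then show ?case using mult_mono[of "\<bar>X s \<omega>\<bar>" 2 "\<bar>X t \<omega>\<bar>" 2] by (simp add: abs_mult)
    qed
  qed simp
  \<comment> \<open>Expectations under \<open>M\<close> are computed by first averaging over the sign.\<close>
  have transfer: "(\<integral>\<omega>. f \<omega> \<partial>M) = (\<integral>l. (f (emb (l, True)) + f (emb (l, False))) / 2 \<partial>\<Phi>)"
    if f: "integrable M f" and [measurable]: "f \<in> borel_measurable Pi" for f :: "(nat \<Rightarrow> real) \<Rightarrow> real"
  proof -
    have "integrable (\<Phi> \<Otimes>\<^sub>M B) (\<lambda>p. f (emb p))"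
      using f unfolding M_def by (subst (asm) integrable_distr_eq) auto
    then have "(\<integral>l. (\<integral>b. f (emb (l, b)) \<partial>B) \<partial>\<Phi>) = (\<integral>p. f (emb p) \<partial>(\<Phi> \<Otimes>\<^sub>M B))"
      by (intro PB.integral_fst')
    moreover have "(\<integral>b. f (emb (l, b)) \<partial>B) = (f (emb (l, True)) + f (emb (l, False))) / 2" for l
      by (simp add: B_def)
    ultimately show ?thesis
      unfolding M_def by (subst integral_distr) simp_all
  qed
  have mean: "(\<integral>\<omega>. X t \<omega> \<partial>M) = 0" for t
  proof (subst transfer)
    show "integrable M (X t)"
      by (rule M.integrable_const_bound[where B = 2]) (use AE_bound[of t] in auto)
  qed (simp_all add: X_emb)
  have cov: "(\<integral>\<omega>. X (s + t) \<omega> * X s \<omega> \<partial>M) = Re (char \<Phi> t)" for s t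
  proof -
    have "(\<integral>\<omega>. X (s + t) \<omega> * X s \<omega> \<partial>M) =
        (\<integral>l. (cos ((s + t) * l) + sin ((s + t) * l)) * (cos (s * l) + sin (s * l)) \<partial>\<Phi>)"
    proof -
      have "(X (s + t) (emb (l, True)) * X s (emb (l, True)) +
          X (s + t) (emb (l, False)) * X s (emb (l, False))) / 2 =
          (cos ((s + t) * l) + sin ((s + t) * l)) * (cos (s * l) + sin (s * l))" for l
        by (simp add: X_emb algebra_simps)
      then show ?thesis
        by (subst transfer[OF int_prod]) simp_all
    qed
    also have "\<dots> = (\<integral>l. cos (t * l) + sin ((2 * s + t) * l) \<partial>\<Phi>)"
    proof (rule Bochner_Integration.integral_cong[OF refl])
      fix l
      have eqs: "t * l = (s + t) * l - s * l" "(2 * s + t) * l = (s + t) * l + s * l"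
        by (simp_all add: algebra_simps)
      show "(cos ((s + t) * l) + sin ((s + t) * l)) * (cos (s * l) + sin (s * l)) =
          cos (t * l) + sin ((2 * s + t) * l)"
        unfolding eqs cos_diff sin_add by (simp add: algebra_simps)
    qed
    also have "\<dots> = (\<integral>l. cos (t * l) \<partial>\<Phi>) + (\<integral>l. sin ((2 * s + t) * l) \<partial>\<Phi>)"
      by (intro Bochner_Integration.integral_add; intro Phi.integrable_const_bound[where B = 1]) auto
    finally show ?thesis
      by (simp add: Phi.Re_char[symmetric] Phi.Im_char[symmetric] real)
  qed
  have cov': "(\<integral>\<omega>. X s \<omega> * X t \<omega> \<partial>M) = Re (char \<Phi> (s - t))" for s t
    using cov[of t "s - t"] by simp
  \<comment> \<open>Mean square continuity reduces to continuity of the characteristic function.\<close>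
  have incr: "(\<integral>\<omega>. (X s \<omega> - X t \<omega>)\<^sup>2 \<partial>M) = 2 - 2 * Re (char \<Phi> (s - t))" for s t
  proof -
    have "(X s \<omega> - X t \<omega>)\<^sup>2 = X s \<omega> * X s \<omega> + X t \<omega> * X t \<omega> - 2 * (X s \<omega> * X t \<omega>)" for \<omega>
      by (simp add: power2_eq_square algebra_simps)
    then show ?thesis
      using int_prod by (simp add: cov' Phi.char_zero)
  qed
  have cont: "((\<lambda>s. \<integral>\<omega>. (X s \<omega> - X t \<omega>)\<^sup>2 \<partial>M) \<longlongrightarrow> 0) (at t)" for t
  proof -
    have "isCont (\<lambda>s. char \<Phi> (s - t)) t"
      by (rule isCont_o2[where g = "char \<Phi>" and f = "\<lambda>s. s - t"]) (auto intro!: Phi.isCont_char)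
    then have "((\<lambda>s. 2 - 2 * Re (char \<Phi> (s - t))) \<longlongrightarrow> 2 - 2 * Re (char \<Phi> (t - t))) (at t)"
      unfolding isCont_def by (intro tendsto_intros)
    then show ?thesis by (simp add: incr Phi.char_zero)
  qed
  have "wss_process M X"
    unfolding wss_process_def
    using M.prob_space_axioms joint int_prod mean cov cont by (simp add: power2_eq_square)
  moreover have "has_spectrum M X \<Phi>"
    unfolding has_spectrum_def cov
    using Phi.finite_measure_axioms real by (auto simp: complex_eq_iff)
  ultimately show ?thesis by blast
qed

section \<open>Covariance of the samples\<close>

text \<open>
  Given the sampling times, the expected product of two samples is \<open>C\<close> at their separation, by
  independence of \<open>X\<close> and \<open>\<tau>\<close>; averaging over the times is Fubini's theorem. Its integrability
  condition holds because \<open>\<bar>x * y\<bar> \<le> x\<^sup>2 + y\<^sup>2\<close> bounds the conditional expectation by \<open>2 * C 0\<close>,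
  whatever the sampling times are.
\<close>
lemma has_sampled_covarianceI:
  fixes C :: "real \<Rightarrow> real"
  assumes X: "wss_process M X" and \<tau>: "sampling_process N \<tau>"
    and C: "\<And>s t. (\<integral>\<omega>. X (s + t) \<omega> * X s \<omega> \<partial>M) = C t"
    and r: "\<And>m n. (\<integral>\<eta>. C (\<tau> (m + n) \<eta> - \<tau> m \<eta>) \<partial>N) = r n"
  shows "has_sampled_covariance M X N \<tau> r"
  unfolding has_sampled_covariance_def
proof (intro allI)
  fix m n :: int
  interpret M: prob_space M using X by (simp add: wss_process_def)
  interpret N: prob_space N using \<tau> by (simp add: sampling_process_def)
  interpret NM: pair_prob_space N M ..
  have [measurable]: "case_prod X \<in> borel_measurable (borel \<Otimes>\<^sub>M M)"
    using X by (simp add: wss_process_def)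
  have [measurable]: "\<tau> k \<in> borel_measurable N" for k
    using \<tau> by (simp add: sampling_process_def)
  have Xm [measurable]: "X s \<in> borel_measurable M" for s
    by measurable
  have sq: "integrable M (\<lambda>\<omega>. (X s \<omega>)\<^sup>2)" for s
    using X by (simp add: wss_process_def)
  have sq_val: "(\<integral>\<omega>. (X s \<omega>)\<^sup>2 \<partial>M) = C 0" for s
    using C[of s 0] by (simp add: power2_eq_square)
  let ?F = "\<lambda>\<eta> \<omega>. X (\<tau> (m + n) \<eta>) \<omega> * X (\<tau> m \<eta>) \<omega>"
  have AMGM: "\<bar>x * y\<bar> \<le> x\<^sup>2 + y\<^sup>2" for x y :: real
    using sum_squares_bound[of "\<bar>x\<bar>" "\<bar>y\<bar>"] abs_ge_zero[of "x * y"]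
    unfolding abs_mult power2_abs by linarith
  have prod: "integrable M (\<lambda>\<omega>. X s \<omega> * X t \<omega>)" for s t
    by (rule Bochner_Integration.integrable_bound[OF Bochner_Integration.integrable_add[OF sq[of s] sq[of t]]])
      (auto intro!: AE_I2 order_trans[OF AMGM])
  have le: "(\<integral>\<omega>. \<bar>X s \<omega> * X t \<omega>\<bar> \<partial>M) \<le> 2 * C 0" for s t
  proof -
    have "(\<integral>\<omega>. \<bar>X s \<omega> * X t \<omega>\<bar> \<partial>M) \<le> (\<integral>\<omega>. (X s \<omega>)\<^sup>2 + (X t \<omega>)\<^sup>2 \<partial>M)"
      by (intro integral_mono Bochner_Integration.integrable_add sq AMGM integrable_abs prod)
    then show ?thesis using sq by (simp add: sq_val)
  qed
  have F_meas [measurable]: "(\<lambda>p. ?F (fst p) (snd p)) \<in> borel_measurable (N \<Otimes>\<^sub>M M)"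
    by measurable
  have int: "integrable (N \<Otimes>\<^sub>M M) (\<lambda>p. ?F (fst p) (snd p))"
  proof (rule NM.Fubini_integrable)
    show "integrable N (\<lambda>\<eta>. \<integral>\<omega>. norm (?F (fst (\<eta>, \<omega>)) (snd (\<eta>, \<omega>))) \<partial>M)"
      by (rule N.integrable_const_bound[where B = "2 * C 0"])
        (auto intro!: AE_I2 le)
  qed (auto simp: prod)
  have "(\<integral>(\<omega>, \<eta>). ?F \<eta> \<omega> \<partial>(M \<Otimes>\<^sub>M N)) = (\<integral>p. ?F (fst p) (snd p) \<partial>(N \<Otimes>\<^sub>M M))"
    using NM.integral_product_swap[OF F_meas] by (simp add: case_prod_beta)
  also have "\<dots> = (\<integral>\<eta>. (\<integral>\<omega>. ?F \<eta> \<omega> \<partial>M) \<partial>N)"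
    using NM.integral_fst'[OF int] by simp
  also have "\<dots> = (\<integral>\<eta>. C (\<tau> (m + n) \<eta> - \<tau> m \<eta>) \<partial>N)"
    using C[of "\<tau> m \<eta>" "\<tau> (m + n) \<eta> - \<tau> m \<eta>" for \<eta>] by simp
  finally show "r n = (\<integral>(\<omega>, \<eta>). ?F \<eta> \<omega> \<partial>(M \<Otimes>\<^sub>M N))"
    by (simp add: r)
qed

lemma separated_gap:
  fixes x :: "int \<Rightarrow> real"
  assumes "d > 0" and gap: "\<And>k. x (k + 1) - x k \<ge> d" and "n \<noteq> 0"
  shows "\<bar>x (m + n) - x m\<bar> \<ge> d"
proof -
  have far: "x (k + 1 + int j) - x k \<ge> d" for k j
  proof (induction j)
    case (Suc j)
    then show ?case using gap[of "k + 1 + int j"] \<open>d > 0\<close> by (simp add: algebra_simps)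
  qed (use gap in simp)
  show ?thesis
  proof (cases "n > 0")
    case True
    then show ?thesis using far[of m "nat (n - 1)"] by simp
  next
    case False
    then show ?thesis using far[of "m + n" "nat (- n - 1)"] \<open>n \<noteq> 0\<close> by simp
  qed
qed

text \<open>
  Distinct samples are separated by at least \<open>d \<ge> a\<close>, that is, almost surely by a lag at which
  the triangle vanishes, so only the variance survives in the sampled covariance.
\<close>
lemma exists_uncorrelated_sampled_process:
  fixes N :: "'b measure"
  assumes "0 < a" "a \<le> d" and \<tau>: "sampling_process N \<tau>" and sep: "separated_sampling N \<tau> d"
  shows "\<exists>(M :: (nat \<Rightarrow> real) measure) X. wss_process M X \<and> has_spectrum M X (fejer_spectrum a) \<and>
    has_sampled_covariance M X N \<tau> (\<lambda>n. if n = 0 then 1 else 0)"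
proof -
  obtain M :: "(nat \<Rightarrow> real) measure" and X
    where X: "wss_process M X" and spec: "has_spectrum M X (fejer_spectrum a)"
    using exists_process_with_spectrum[OF real_distribution_fejer_spectrum[OF \<open>0 < a\<close>]]
      char_fejer_spectrum[OF \<open>0 < a\<close>] by auto
  interpret N: prob_space N using \<tau> by (simp add: sampling_process_def)
  let ?C = "\<lambda>t. max 0 (1 - \<bar>t\<bar> / a)"
  have [measurable]: "\<tau> k \<in> borel_measurable N" for k
    using \<tau> by (simp add: sampling_process_def)
  have "has_sampled_covariance M X N \<tau> (\<lambda>n. if n = 0 then 1 else 0)"
  proof (rule has_sampled_covarianceI[OF X \<tau>])
    show "(\<integral>\<omega>. X (s + t) \<omega> * X s \<omega> \<partial>M) = ?C t" for s t
      using spec unfolding has_spectrum_def char_fejer_spectrum[OF \<open>0 < a\<close>] of_real_eq_iff by blast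
    show "(\<integral>\<eta>. ?C (\<tau> (m + n) \<eta> - \<tau> m \<eta>) \<partial>N) = (if n = 0 then 1 else 0)" for m n
    proof (cases "n = 0")
      case False
      have "AE \<eta> in N. ?C (\<tau> (m + n) \<eta> - \<tau> m \<eta>) = 0"
        using sep unfolding separated_sampling_def
      proof eventually_elim
        case (elim \<eta>)
        then have "\<bar>\<tau> (m + n) \<eta> - \<tau> m \<eta>\<bar> \<ge> d"
          using assms(1,2) False by (intro separated_gap) auto
        then show ?case using assms(1,2) by (simp add: max_def field_simps)
      qed
      then have "(\<integral>\<eta>. ?C (\<tau> (m + n) \<eta> - \<tau> m \<eta>) \<partial>N) = (\<integral>\<eta>. 0 \<partial>N)"
        by (intro integral_cong_AE) auto
      then show ?thesis using False by simp
    qed (simp add: N.prob_space)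
  qed
  with X spec show ?thesis by blast
qed

theorem theorem1:
  fixes N :: "'b measure" and \<tau> :: "int \<Rightarrow> 'b \<Rightarrow> real" and d :: real
  assumes "d > 0"
    and "sampling_process N \<tau>"
    and "stationary_sampling N \<tau>"
    and "separated_sampling N \<tau> d"
  shows "\<not> alias_free N \<tau> all_spectra"
proof -
  let ?\<Phi>\<^sub>1 = "fejer_spectrum d" and ?\<Phi>\<^sub>2 = "fejer_spectrum (d / 2)"
  \<comment> \<open>At \<open>d / 2\<close> the wide triangle has the value \<open>1 / 2\<close>, and the narrow one vanishes.\<close>
  have ne: "?\<Phi>\<^sub>1 \<noteq> ?\<Phi>\<^sub>2"
  proof
    assume "?\<Phi>\<^sub>1 = ?\<Phi>\<^sub>2"
    then have "char ?\<Phi>\<^sub>1 (d / 2) = char ?\<Phi>\<^sub>2 (d / 2)" by simp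
    then show False
      using \<open>d > 0\<close> by (simp add: char_fejer_spectrum max_def)
  qed
  obtain M\<^sub>1 :: "(nat \<Rightarrow> real) measure" and X\<^sub>1 where 1: "wss_process M\<^sub>1 X\<^sub>1"
      "has_spectrum M\<^sub>1 X\<^sub>1 ?\<Phi>\<^sub>1"
      "has_sampled_covariance M\<^sub>1 X\<^sub>1 N \<tau> (\<lambda>n. if n = 0 then 1 else 0)"
    using exists_uncorrelated_sampled_process[of d d N \<tau>] assms by auto
  obtain M\<^sub>2 :: "(nat \<Rightarrow> real) measure" and X\<^sub>2 where 2: "wss_process M\<^sub>2 X\<^sub>2"
      "has_spectrum M\<^sub>2 X\<^sub>2 ?\<Phi>\<^sub>2"
      "has_sampled_covariance M\<^sub>2 X\<^sub>2 N \<tau> (\<lambda>n. if n = 0 then 1 else 0)"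
    using exists_uncorrelated_sampled_process[of "d / 2" d N \<tau>] assms by auto
  have "?\<Phi>\<^sub>1 \<in> all_spectra" "?\<Phi>\<^sub>2 \<in> all_spectra"
    using 1 2 unfolding all_spectra_def by blast+
  with 1 2 ne show ?thesis
    unfolding alias_free_def by blast
qed

end
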